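(* Let $\alpha > -\frac12$ and let $1 \le p \le \infty$. Then the following holds: (a) For any function $\varphi:(0,+\infty)\to(0,+\infty)$ with $\varphi(r)\to\infty$ as $r\to\infty$ there is a $\Lambda_\alpha$-hypercyclic entire function $f$ with $$M_p(f,r)\le \varphi(r)\,\frac{e^r}{r^{\alpha+1}}\quad\text{for all sufficiently large } r>0.$$ (b) There is no $\Lambda_\alpha$-hypercyclic entire function $f$ for which there exists a constant $C>0$ such that $$M_p(f,r)\le C\,\frac{e^r}{r^{\alpha+1}}\quad\text{for all } r>0.$$
   Context: $H(\mathbb{C})$ is the vector space of all entire functions $\mathbb{C}\to\mathbb{C}$ with the topology of local uniform convergence (uniform convergence on compact sets). For $\alpha>-\frac12$, the Dunkl operator $\Lambda_\alpha:H(\mathbb{C})\to H(\mathbb{C})$ is the continuous linear operator given by $$\Lambda_\alpha f(z)=f'(z)+\frac{2\alpha+1}{z}\cdot\frac{f(z)-f(-z)}{2},$$ where the value at $z=0$ is understood by removing the singularity. A function $f\in H(\mathbb{C})$ is $\Lambda_\alpha$-hypercyclic if its orbit $\{\Lambda_\alpha^n f: n\in\mathbb{N}\}$ is dense in $H(\mathbb{C})$, where $\mathbb{N}=\{1,2,3,\dots\}$. For an entire function $f$ and $r>0$, $M_p(f,r)=\Big(\frac{1}{2\pi}\int_0^{2\pi}|f(re^{it})|^p\,dt\Big)^{1/p}$ if $1\le p<\infty$, and $M_\infty(f,r)=\sup_{|z|=r}|f(z)|$. *)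

theory Defs
  imports "HOL-Complex_Analysis.Complex_Analysis"
begin

definition entire_functions :: "(complex \<Rightarrow> complex) set" where
  "entire_functions = {f. f holomorphic_on UNIV}"

definition unif_nbhd ::
    "(complex \<Rightarrow> complex) \<Rightarrow> complex set \<Rightarrow> real \<Rightarrow> (complex \<Rightarrow> complex) set" where
  "unif_nbhd f K e = {g \<in> entire_functions. \<forall>z\<in>K. norm (g z - f z) < e}"

(* The topology of uniform convergence on compact sets: the sets unif_nbhd f K e with K compact
   and e > 0 are a neighbourhood base at the entire function f (see openin_unif_nbhd below). *)
definition entire_topology :: "(complex \<Rightarrow> complex) topology" where
  "entire_topology = topology (\<lambda>U. U \<subseteq> entire_functions \<and>
     (\<forall>f\<in>U. \<exists>K e. compact K \<and> e > 0 \<and> unif_nbhd f K e \<subseteq> U))"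

lemma openin_entire_topology:
  "openin entire_topology U \<longleftrightarrow> U \<subseteq> entire_functions \<and>
     (\<forall>f\<in>U. \<exists>K e. compact K \<and> e > 0 \<and> unif_nbhd f K e \<subseteq> U)"
proof -
  let ?P = "\<lambda>U. U \<subseteq> entire_functions \<and>
     (\<forall>f\<in>U. \<exists>K e. compact K \<and> e > 0 \<and> unif_nbhd f K e \<subseteq> U)"
  have "?P (S \<inter> T)" if S: "?P S" and T: "?P T" for S T
  proof (intro conjI ballI)
    fix f assume f: "f \<in> S \<inter> T"
    obtain K e where 1: "compact K" "e > 0" "unif_nbhd f K e \<subseteq> S" using S f by blast
    obtain L d where 2: "compact L" "d > 0" "unif_nbhd f L d \<subseteq> T" using T f by blast
    have "unif_nbhd f (K \<union> L) (min e d) \<subseteq> S \<inter> T"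
      using 1(3) 2(3) by (auto simp: unif_nbhd_def subset_iff)
    then show "\<exists>K e. compact K \<and> e > 0 \<and> unif_nbhd f K e \<subseteq> S \<inter> T"
      using 1 2 by (intro exI[of _ "K \<union> L"] exI[of _ "min e d"]) auto
  qed (use S in blast)
  moreover have "?P (\<Union>\<K>)" if "\<forall>S\<in>\<K>. ?P S" for \<K>
    using that by (meson Sup_least UnionE Union_upper subset_trans)
  ultimately have "istopology ?P" unfolding istopology_def by blast
  then show ?thesis unfolding entire_topology_def by (simp add: topology_inverse')
qed

lemma topspace_entire_topology [simp]: "topspace entire_topology = entire_functions"
proof -
  have "openin entire_topology entire_functions"
    unfolding openin_entire_topology
    by (auto simp: unif_nbhd_def intro!: exI[of _ "{}"] exI[of _ "1::real"])
  then show ?thesis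
    using openin_entire_topology openin_subset topspace_def by (metis openin_topspace subset_antisym)
qed

lemma openin_unif_nbhd:
  assumes f: "f \<in> entire_functions" and K: "compact K"
  shows "openin entire_topology (unif_nbhd f K e)"
  unfolding openin_entire_topology
proof (intro conjI ballI)
  fix g assume g: "g \<in> unif_nbhd f K e"
  have "\<exists>d>0. \<forall>z\<in>K. norm (g z - f z) + d \<le> e"
  proof (cases "K = {}")
    case False
    have "continuous_on K (\<lambda>z. norm (g z - f z))"
      using f g by (intro continuous_intros)
        (auto simp: entire_functions_def unif_nbhd_def
              intro: continuous_on_subset holomorphic_on_imp_continuous_on)
    then obtain w where "w \<in> K" "\<forall>z\<in>K. norm (g z - f z) \<le> norm (g w - f w)"
      using continuous_attains_sup[OF K False] by blast
    then show ?thesis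
      using g by (intro exI[of _ "e - norm (g w - f w)"]) (auto simp: unif_nbhd_def)
  qed (auto intro: exI[of _ "1::real"])
  then obtain d where d: "d > 0" "\<And>z. z \<in> K \<Longrightarrow> norm (g z - f z) + d \<le> e" by blast
  have "unif_nbhd g K d \<subseteq> unif_nbhd f K e"
  proof
    fix h assume h: "h \<in> unif_nbhd g K d"
    have "norm (h z - f z) < e" if "z \<in> K" for z
    proof -
      have "norm (h z - f z) \<le> norm (h z - g z) + norm (g z - f z)"
        using norm_triangle_ineq[of "h z - g z" "g z - f z"] by simp
      also have "\<dots> < d + norm (g z - f z)" using h that by (simp add: unif_nbhd_def)
      finally show ?thesis using d(2)[OF that] by linarith
    qed
    then show "h \<in> unif_nbhd f K e" using h by (simp add: unif_nbhd_def)
  qed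
  then show "\<exists>L d. compact L \<and> d > 0 \<and> unif_nbhd g L d \<subseteq> unif_nbhd f K e"
    using K d(1) by blast
qed (auto simp: unif_nbhd_def)

(* remove_sings fills in the value at 0; elsewhere it changes nothing when f is entire. *)
definition dunkl :: "real \<Rightarrow> (complex \<Rightarrow> complex) \<Rightarrow> complex \<Rightarrow> complex" where
  "dunkl \<alpha> f = remove_sings
     (\<lambda>z. deriv f z + of_real (2 * \<alpha> + 1) / z * ((f z - f (- z)) / 2))"

lemma dunkl_nonzero:
  assumes f: "f \<in> entire_functions" and z: "z \<noteq> 0"
  shows "dunkl \<alpha> f z = deriv f z + of_real (2 * \<alpha> + 1) / z * ((f z - f (- z)) / 2)"
proof -
  have h: "f holomorphic_on UNIV" using f by (simp add: entire_functions_def)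
  have m: "(\<lambda>z. f (- z)) holomorphic_on - {0}"
    using holomorphic_on_compose_gen[of uminus "- {0}" f UNIV] h
    by (simp add: o_def holomorphic_on_minus)
  have "(\<lambda>z. deriv f z + of_real (2 * \<alpha> + 1) / z * ((f z - f (- z)) / 2)) holomorphic_on - {0}"
    using h m holomorphic_deriv[OF h open_UNIV]
    by (intro holomorphic_intros) (auto intro: holomorphic_on_subset)
  then show ?thesis
    unfolding dunkl_def using z
    by (intro remove_sings_at_analytic) (auto simp: analytic_at intro!: exI[of _ "- {0}"])
qed

lemma dunkl_tendsto_zero:
  assumes f: "f \<in> entire_functions"
  shows "(\<lambda>z. deriv f z + of_real (2 * \<alpha> + 1) / z * ((f z - f (- z)) / 2))
           \<midarrow>0\<rightarrow> of_real (2 * \<alpha> + 2) * deriv f 0"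
proof -
  have h: "f holomorphic_on UNIV" using f by (simp add: entire_functions_def)
  have d: "(f has_field_derivative deriv f 0) (at 0)"
    using h by (intro holomorphic_derivI) auto
  have "((\<lambda>z. f (- z)) has_field_derivative deriv f (- 0) * (- 1)) (at 0)"
    by (rule DERIV_chain2[where g = uminus]) (use d in \<open>auto intro!: derivative_eq_intros\<close>)
  with d have "((\<lambda>z. f z - f (- z)) has_field_derivative 2 * deriv f 0) (at 0)"
    by (auto intro!: derivative_eq_intros)
  then have q: "(\<lambda>z. (f z - f (- z)) / z) \<midarrow>0\<rightarrow> 2 * deriv f 0"
    by (simp add: has_field_derivative_iff)
  have "deriv f \<midarrow>0\<rightarrow> deriv f 0"
    using holomorphic_deriv[OF h open_UNIV] holomorphic_on_imp_continuous_on
    by (metis UNIV_I continuous_on_def)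
  from tendsto_add[OF this tendsto_mult_left[OF q, of "of_real (2 * \<alpha> + 1) / 2"]]
  show ?thesis by (simp add: algebra_simps add_divide_distrib diff_divide_distrib)
qed

lemma dunkl_zero:
  assumes "f \<in> entire_functions"
  shows "dunkl \<alpha> f 0 = of_real (2 * \<alpha> + 2) * deriv f 0"
  unfolding dunkl_def by (rule remove_sings_eqI[OF dunkl_tendsto_zero[OF assms]])

lemma dunkl_entire:
  assumes f: "f \<in> entire_functions"
  shows "dunkl \<alpha> f \<in> entire_functions"
proof -
  let ?D = "\<lambda>z. deriv f z + of_real (2 * \<alpha> + 1) / z * ((f z - f (- z)) / 2)"
  have h: "f holomorphic_on UNIV" using f by (simp add: entire_functions_def)
  have m: "(\<lambda>z. f (- z)) holomorphic_on UNIV - {0}"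
    using holomorphic_on_compose_gen[of uminus "UNIV - {0}" f UNIV] h
    by (simp add: o_def holomorphic_on_minus)
  have "?D holomorphic_on UNIV - {0}"
    using h m holomorphic_deriv[OF h open_UNIV]
    by (intro holomorphic_intros) (auto intro: holomorphic_on_subset)
  from removable_singularity[OF this open_UNIV dunkl_tendsto_zero[OF f]]
  have "(\<lambda>z. if z = 0 then of_real (2 * \<alpha> + 2) * deriv f 0 else ?D z) holomorphic_on UNIV" .
  also have "(\<lambda>z. if z = 0 then of_real (2 * \<alpha> + 2) * deriv f 0 else ?D z) = dunkl \<alpha> f"
    using dunkl_nonzero[OF f] dunkl_zero[OF f] by fastforce
  finally show ?thesis by (simp add: entire_functions_def)
qed

(* The orbit starts at n = 1. *)
definition dunkl_hypercyclic :: "real \<Rightarrow> (complex \<Rightarrow> complex) \<Rightarrow> bool" where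
  "dunkl_hypercyclic \<alpha> f \<longleftrightarrow> f \<in> entire_functions \<and>
     entire_topology closure_of {(dunkl \<alpha> ^^ n) f | n. n \<ge> 1} = topspace entire_topology"

(* rcis r t = r * exp (i t); only exponents 1 <= p <= infinity are meant. *)
definition integral_mean :: "ereal \<Rightarrow> (complex \<Rightarrow> complex) \<Rightarrow> real \<Rightarrow> real" where
  "integral_mean p f r =
     (if p = \<infinity> then (SUP z\<in>sphere 0 r. norm (f z))
      else (1 / (2 * pi) * integral {0..2 * pi} (\<lambda>t. norm (f (rcis r t)) powr real_of_ereal p))
             powr (1 / real_of_ereal p))"

end

theory Submission
  imports Defs "HOL-Real_Asymp.Real_Asymp" "HOL-Library.Nat_Bijection"
begin

text \<open>
  The Dunkl operator maps \<open>z\<^sup>n\<close> to \<open>c\<^sub>n z\<^bsup>n-1\<^esup>\<close> with \<open>c\<^sub>n = n\<close> for even \<open>n\<close> and \<open>c\<^sub>n = n + 2 \<alpha> + 1\<close> for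
  odd \<open>n\<close>. With \<open>\<gamma>\<^sub>n = c\<^sub>1 \<dots> c\<^sub>n\<close> it acts on \<open>f(z) = \<Sum> w\<^sub>n z\<^sup>n / \<gamma>\<^sub>n\<close> as the left shift of \<open>w\<close>. A Stirling
  estimate shows that \<open>\<gamma>\<^sub>n\<close> is comparable to \<open>s\<^sup>s e\<^bsup>-s\<^esup> = sup\<^bsub>r>0\<^esub> r\<^sup>s e\<^bsup>-r\<^esup>\<close> for \<open>s = n + \<alpha> + 1\<close>, that is,
  \<open>r\<^sup>n / \<gamma>\<^sub>n\<close> is at most a constant times \<open>e\<^sup>r / r\<^bsup>\<alpha>+1\<^esup>\<close>, with equality of orders at \<open>r = s\<close>.

  If \<open>M\<^sub>p(f, r) \<le> C e\<^sup>r / r\<^bsup>\<alpha>+1\<^esup>\<close>, the Cauchy estimate at \<open>r = s\<close> therefore bounds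
  \<open>w\<^sub>n = (\<Lambda>\<^sup>n f)(0)\<close>, so the orbit is not dense. Conversely, let \<open>w\<close> consist of blocks which run
  through a countable dense set of polynomials, each occurring infinitely often and starting at
  rapidly increasing positions \<open>n\<^sub>j\<close>. Then \<open>\<Lambda>\<^bsup>n\<^sub>j\<^esup> f\<close> is close to the \<open>j\<close>-th polynomial, and each block
  contributes only a constant multiple of \<open>e\<^sup>r / r\<^bsup>\<alpha>+1\<^esup>\<close>; starting block \<open>j\<close> late makes it negligible
  until \<open>\<phi>\<close> exceeds the sum of the first \<open>j + 1\<close> constants.
\<close>

section \<open>Weights of the Dunkl shift and their Stirling asymptotics\<close>

definition dunkl_factor :: "real \<Rightarrow> nat \<Rightarrow> real" where
  "dunkl_factor \<alpha> k = real k + (if odd k then 2 * \<alpha> + 1 else 0)"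

definition dunkl_fact :: "real \<Rightarrow> nat \<Rightarrow> real" where
  "dunkl_fact \<alpha> n = (\<Prod>k=1..n. dunkl_factor \<alpha> k)"

lemma dunkl_fact_0 [simp]: "dunkl_fact \<alpha> 0 = 1"
  by (simp add: dunkl_fact_def)

lemma dunkl_fact_Suc: "dunkl_fact \<alpha> (Suc n) = dunkl_factor \<alpha> (Suc n) * dunkl_fact \<alpha> n"
  by (simp add: dunkl_fact_def prod.atLeastAtMost_shift_bounds prod.nat_ivl_Suc')

text \<open>Every factor is at least its index because 2 \<alpha> + 1 > 0. The comparison gives
  positivity here and the decay of \<open>R ^ n / dunkl_fact \<alpha> n\<close> later.\<close>

lemma fact_le_dunkl_fact:
  assumes "\<alpha> > - 1 / 2"
  shows "fact n \<le> dunkl_fact \<alpha> n"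
proof (induction n)
  case (Suc n)
  then show ?case
    using assms unfolding dunkl_fact_Suc fact_Suc of_nat_fact
    by (intro mult_mono) (auto simp: dunkl_factor_def)
qed simp

lemma dunkl_fact_pos:
  assumes "\<alpha> > - 1 / 2"
  shows "dunkl_fact \<alpha> n > 0"
  using fact_le_dunkl_fact[OF assms, of n] fact_gt_zero[of n, where 'a = real] by linarith

lemma bounded_of_summable_differences:
  fixes f :: "nat \<Rightarrow> real"
  assumes "summable (\<lambda>n. f (Suc n) - f n)"
  shows "\<exists>D. \<forall>n. \<bar>f n\<bar> \<le> D"
proof -
  have "convergent (\<lambda>n. f 0 + (\<Sum>k<n. f (Suc k) - f k))"
    using assms by (intro convergent_add convergent_const) (simp add: summable_iff_convergent)
  then have "Bseq f"
    by (simp add: sum_lessThan_telescope convergent_imp_Bseq)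
  then show ?thesis by (auto simp: Bseq_def)
qed

text \<open>
  The two-step increment of \<open>ln (dunkl_fact \<alpha> n)\<close> is \<open>ln ((s + 1)\<^sup>2 - c)\<close> with \<open>s = n + \<alpha> + 1\<close>, where
  \<open>c = \<alpha>\<^sup>2\<close> for even \<open>n\<close> and \<open>c = (\<alpha> + 1)\<^sup>2\<close> for odd \<open>n\<close>; it differs from the increment of
  \<open>s ln s - s\<close> by \<open>O(1 / n\<^sup>2)\<close>.
\<close>

lemma bounded_along_steps_of_two:
  fixes c b :: real and d :: "nat \<Rightarrow> real" and i :: nat
  assumes c: "c \<ge> 0" and step: "\<And>m. d (Suc (Suc (2 * m + i))) - d (2 * m + i) =
     ln ((2 * real m + b + 1)\<^sup>2 - c) -
     ((2 * real m + b + 2) * ln (2 * real m + b + 2) - (2 * real m + b) * ln (2 * real m + b) - 2)"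
  shows "\<exists>D. \<forall>m. \<bar>d (2 * m + i)\<bar> \<le> D"
proof -
  \<comment> \<open>This is ln (1 - c / \<open>x\<^sup>2\<close>): identically zero for c = 0, with
    leading term - c / \<open>x\<^sup>2\<close> for c > 0, hence the case split.\<close>
  have 1: "(\<lambda>x::real. ln (x\<^sup>2 - c) - 2 * ln x) \<in> O(\<lambda>x. 1 / x ^ 2)"
  proof (cases "c = 0")
    case True
    have "\<forall>\<^sub>F x::real in at_top. ln (x\<^sup>2 - c) - 2 * ln x = 0"
      using eventually_gt_at_top[of 0] by eventually_elim (simp add: True ln_realpow)
    then show ?thesis by (subst landau_o.big.in_cong[where g = "\<lambda>_. 0"]) auto
  next
    case False
    then have "c > 0" using c by simp
    then show ?thesis by real_asymp
  qed
  \<comment> \<open>With F(x) = x ln x - x this is F(x + 1) - F(x - 1) - 2 F'(x). Centring at x = s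
    + 1 cancels the F'' terms of order 1 / x, which leaves the order of F'''.\<close>
  have 2: "(\<lambda>x::real. (x + 1) * ln (x + 1) - (x - 1) * ln (x - 1) - 2 - 2 * ln x) \<in> O(\<lambda>x. 1 / x ^ 2)"
    by real_asymp
  have "filterlim (\<lambda>m. 2 * real m + b + 1) at_top sequentially"
    by real_asymp
  note big = landau_o.big.compose[OF sum_in_bigo(2)[OF 1 2] this]
  have "d (2 * Suc m + i) - d (2 * m + i) =
      ln ((2 * real m + b + 1)\<^sup>2 - c) - 2 * ln (2 * real m + b + 1) -
      ((2 * real m + b + 1 + 1) * ln (2 * real m + b + 1 + 1) -
       (2 * real m + b + 1 - 1) * ln (2 * real m + b + 1 - 1) - 2 - 2 * ln (2 * real m + b + 1))" for m
    using step[of m] by (simp add: add.commute[of 2])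
  then have "(\<lambda>m. d (2 * Suc m + i) - d (2 * m + i)) \<in> O(\<lambda>m. 1 / (2 * real m + b + 1) ^ 2)"
    using big by (simp only:)
  also have "(\<lambda>m. 1 / (2 * real m + b + 1) ^ 2) \<in> O(\<lambda>m. 1 / real m ^ 2)"
    by real_asymp
  finally have "(\<lambda>m. d (2 * Suc m + i) - d (2 * m + i)) \<in> O(\<lambda>m. 1 / real m ^ 2)" .
  moreover have "summable (\<lambda>m. norm (1 / real m ^ 2))"
    using inverse_power_summable[of 2, where 'a = real] by (simp add: field_simps)
  ultimately have "summable (\<lambda>m. d (2 * Suc m + i) - d (2 * m + i))"
    by (rule summable_comparison_test_bigo[rotated])
  from bounded_of_summable_differences[of "\<lambda>m. d (2 * m + i)", OF this] show ?thesis .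
qed

text \<open>A single increment of the difference is (\<alpha> + 1/2) / n to first order, with a sign
  alternating with the parity of n. Two consecutive steps cancel this, so even and odd indices are
  treated as separate sequences.\<close>

lemma dunkl_fact_stirling:
  assumes \<alpha>: "\<alpha> > - 1 / 2"
  shows "\<exists>D. \<forall>n. \<bar>ln (dunkl_fact \<alpha> n) - ((real n + \<alpha> + 1) * ln (real n + \<alpha> + 1) - (real n + \<alpha> + 1))\<bar> \<le> D"
proof -
  define d where "d = (\<lambda>n. ln (dunkl_fact \<alpha> n) -
    ((real n + \<alpha> + 1) * ln (real n + \<alpha> + 1) - (real n + \<alpha> + 1)))"
  have step: "d (Suc (Suc n)) - d n = ln (dunkl_factor \<alpha> (Suc (Suc n)) * dunkl_factor \<alpha> (Suc n)) -
     ((real n + \<alpha> + 3) * ln (real n + \<alpha> + 3) - (real n + \<alpha> + 1) * ln (real n + \<alpha> + 1) - 2)" for n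
  proof -
    have "dunkl_factor \<alpha> (Suc k) > 0" for k using \<alpha> by (auto simp: dunkl_factor_def)
    then have "ln (dunkl_fact \<alpha> (Suc (Suc n))) =
        ln (dunkl_factor \<alpha> (Suc (Suc n)) * dunkl_factor \<alpha> (Suc n)) + ln (dunkl_fact \<alpha> n)"
      using dunkl_fact_pos[OF \<alpha>, of n]
      by (simp only: dunkl_fact_Suc mult.assoc[symmetric] ln_mult_pos mult_pos_pos)
    then show ?thesis by (simp add: d_def algebra_simps)
  qed
  have "\<exists>D. \<forall>m. \<bar>d (2 * m + 0)\<bar> \<le> D"
    by (rule bounded_along_steps_of_two[where b = "\<alpha> + 1" and c = "\<alpha>\<^sup>2"], simp, subst step)
       (simp add: dunkl_factor_def algebra_simps power2_eq_square)
  moreover have "\<exists>D. \<forall>m. \<bar>d (2 * m + 1)\<bar> \<le> D"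
    by (rule bounded_along_steps_of_two[where b = "\<alpha> + 2" and c = "(\<alpha> + 1)\<^sup>2"], simp, subst step)
       (simp add: dunkl_factor_def algebra_simps power2_eq_square)
  ultimately obtain D E where DE: "\<And>m. \<bar>d (2 * m)\<bar> \<le> D" "\<And>m. \<bar>d (2 * m + 1)\<bar> \<le> E"
    by auto
  have "\<bar>d n\<bar> \<le> max D E" for n
    using DE(1)[of "n div 2"] DE(2)[of "n div 2"]
    by (cases "even n") (simp_all add: le_max_iff_disj)
  then show ?thesis unfolding d_def by blast
qed

text \<open>Logarithmic form of the fact that \<open>r powr s * exp (- r)\<close> is maximal at r =
  s; it is ln x <= x - 1 at x = r / s.\<close>

lemma exp_powr_sup:
  fixes r s :: real
  assumes "r > 0" "s > 0"
  shows "s * ln r - r \<le> s * ln s - s"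
proof -
  have "s * ln (r / s) \<le> s * (r / s - 1)"
    using assms by (intro mult_left_mono ln_le_minus_one) auto
  then show ?thesis using assms by (simp add: ln_div algebra_simps)
qed

text \<open>Moving \<open>r powr (\<alpha> + 1)\<close> to the other side turns the exponent n into
  s = n + \<alpha> + 1, and K = exp D with the Stirling constant D. The first bound serves the
  construction, the second, at the maximizing radius s, the nonexistence proof.\<close>

lemma dunkl_fact_bounds:
  assumes \<alpha>: "\<alpha> > - 1 / 2"
  obtains K where "K > 0"
    "\<And>n r. r > 0 \<Longrightarrow> r ^ n / dunkl_fact \<alpha> n \<le> K * (exp r / r powr (\<alpha> + 1))"
    "\<And>n. dunkl_fact \<alpha> n * (exp (real n + \<alpha> + 1) / (real n + \<alpha> + 1) powr (\<alpha> + 1)) / (real n + \<alpha> + 1) ^ n \<le> K"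
proof -
  obtain D where D: "\<And>n. \<bar>ln (dunkl_fact \<alpha> n) - ((real n + \<alpha> + 1) * ln (real n + \<alpha> + 1) - (real n + \<alpha> + 1))\<bar> \<le> D"
    using dunkl_fact_stirling[OF \<alpha>] by blast
  show thesis
  proof (rule that[of "exp D"])
    fix n :: nat and r :: real assume r: "r > 0"
    have "r ^ n / dunkl_fact \<alpha> n = exp (real n * ln r - ln (dunkl_fact \<alpha> n))"
      using r dunkl_fact_pos[OF \<alpha>, of n] by (simp add: exp_diff exp_of_nat_mult)
    also have "\<dots> \<le> exp (D + (r - (\<alpha> + 1) * ln r))"
      using exp_powr_sup[of r "real n + \<alpha> + 1"] r \<alpha> abs_le_D2[OF D[of n]]
      by (simp add: algebra_simps)
    also have "\<dots> = exp D * (exp r / r powr (\<alpha> + 1))"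
      using r by (simp only: exp_add exp_diff) (simp add: powr_def)
    finally show "r ^ n / dunkl_fact \<alpha> n \<le> exp D * (exp r / r powr (\<alpha> + 1))" .
  next
    fix n :: nat
    define s where "s = real n + \<alpha> + 1"
    have s: "s > 0" using \<alpha> by (simp add: s_def)
    have "dunkl_fact \<alpha> n * (exp s / s powr (\<alpha> + 1)) / s ^ n =
      exp (ln (dunkl_fact \<alpha> n) + (s - (\<alpha> + 1) * ln s) - real n * ln s)"
      using s dunkl_fact_pos[OF \<alpha>, of n]
      by (simp only: exp_add exp_diff exp_of_nat_mult exp_ln powr_def) simp
    also have "\<dots> \<le> exp D"
      using abs_le_D1[OF D[of n]] by (simp add: s_def algebra_simps)
    finally show "dunkl_fact \<alpha> n * (exp (real n + \<alpha> + 1) / (real n + \<alpha> + 1) powr (\<alpha> + 1)) / (real n + \<alpha> + 1) ^ n \<le> exp D"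
      by (simp add: s_def)
  qed simp
qed

section \<open>The Dunkl operator on power series\<close>

lemma entire_power_series:
  assumes "\<And>z. (\<lambda>n. a n * z ^ n) sums f z"
  shows "f \<in> entire_functions"
    and "(\<lambda>n. of_nat (Suc n) * a (Suc n) * z ^ n) sums deriv f z"
proof -
  have sm: "summable (\<lambda>n. a n * z ^ n)" for z
    using assms sums_summable by blast
  have f: "f = (\<lambda>z. \<Sum>n. a n * z ^ n)"
    using assms sums_unique by blast
  have D: "(f has_field_derivative (\<Sum>n. diffs a n * z ^ n)) (at z)" for z
    unfolding f by (rule termdiffs_strong_converges_everywhere[OF sm])
  then show "f \<in> entire_functions"
    by (auto simp: entire_functions_def holomorphic_on_open)
  show "(\<lambda>n. of_nat (Suc n) * a (Suc n) * z ^ n) sums deriv f z"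
    using summable_sums[OF termdiff_converges_all[OF sm], of z] DERIV_imp_deriv[OF D]
    by (simp add: diffs_def)
qed

lemma entire_taylor_sums:
  assumes "f \<in> entire_functions"
  shows "(\<lambda>n. (deriv ^^ n) f 0 / fact n * z ^ n) sums f z"
proof -
  have "f holomorphic_on ball 0 (norm z + 1)"
    using assms by (auto simp: entire_functions_def intro: holomorphic_on_subset)
  from holomorphic_power_series[OF this, of z] show ?thesis by simp
qed

text \<open>The difference f(z) - f(-z) retains only odd powers, which adds 2 \<alpha> + 1 to the
  odd factors. At z = 0 the filled-in value matches because 2 \<alpha> + 2 is the factor of index
  1.\<close>

lemma dunkl_sums:
  assumes f: "\<And>z. (\<lambda>n. a n * z ^ n) sums f z"
  shows "(\<lambda>n. of_real (dunkl_factor \<alpha> (Suc n)) * a (Suc n) * z ^ n) sums dunkl \<alpha> f z"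
proof -
  note ent = entire_power_series(1)[of a f, OF f]
  note der = entire_power_series(2)[of a f, OF f]
  show ?thesis
  proof (cases "z = 0")
    case True
    have "deriv f 0 = a 1"
      using der[of 0] sums_unique2 powser_sums_zero[of "\<lambda>n. of_nat (Suc n) * a (Suc n)"] by fastforce
    then show ?thesis
      using powser_sums_zero[of "\<lambda>n. of_real (dunkl_factor \<alpha> (Suc n)) * a (Suc n)"] True
      by (simp add: dunkl_zero[OF ent] dunkl_factor_def)
  next
    case False
    have "(\<lambda>n. (a n * z ^ n - a n * (- z) ^ n) / 2) sums ((f z - f (- z)) / 2)"
      by (intro sums_divide sums_diff f)
    also have "(\<lambda>n. (a n * z ^ n - a n * (- z) ^ n) / 2) = (\<lambda>n. if odd n then a n * z ^ n else 0)"
      by (auto simp: power_minus_odd)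
    finally have "(\<lambda>n. if odd (Suc n) then a (Suc n) * z ^ Suc n else 0) sums ((f z - f (- z)) / 2)"
      by (subst sums_Suc_iff) simp
    from sums_mult[OF this, of "of_real (2 * \<alpha> + 1) / z"]
    have "(\<lambda>n. of_real (if odd (Suc n) then 2 * \<alpha> + 1 else 0) * a (Suc n) * z ^ n) sums
        (of_real (2 * \<alpha> + 1) / z * ((f z - f (- z)) / 2))"
      by (rule back_subst[where P = "\<lambda>g. g sums _"]) (use False in \<open>auto simp: field_simps\<close>)
    from sums_add[OF der[of z] this] show ?thesis
      unfolding dunkl_nonzero[OF ent False]
      by (rule back_subst[where P = "\<lambda>g. g sums _"]) (auto simp: dunkl_factor_def algebra_simps)
  qed
qed

text \<open>In the coordinates w the factor produced by \<open>dunkl_sums\<close> cancels against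
  the last factor of the next weight, so the weighted shift becomes the plain left shift.\<close>

lemma dunkl_funpow_sums:
  assumes \<alpha>: "\<alpha> > - 1 / 2"
    and f: "\<And>z. (\<lambda>n. w n / of_real (dunkl_fact \<alpha> n) * z ^ n) sums f z"
  shows "(\<lambda>n. w (n + m) / of_real (dunkl_fact \<alpha> n) * z ^ n) sums (dunkl \<alpha> ^^ m) f z"
proof (induction m arbitrary: z)
  case (Suc m)
  from dunkl_sums[OF Suc.IH, of \<alpha> z] show ?case
  proof (simp, elim back_subst[where P = "\<lambda>g. g sums _"], intro ext)
    fix n
    have "dunkl_factor \<alpha> (Suc n) \<noteq> 0"
      using dunkl_fact_pos[OF \<alpha>, of "Suc n"] by (auto simp: dunkl_fact_Suc)
    then show "of_real (dunkl_factor \<alpha> (Suc n)) * w (Suc (n + m)) * z ^ n / of_real (dunkl_fact \<alpha> (Suc n)) =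
        w (Suc (n + m)) * z ^ n / of_real (dunkl_fact \<alpha> n)"
      by (simp add: dunkl_fact_Suc)
  qed
qed (use f in simp)

lemma dunkl_funpow_at_zero:
  assumes \<alpha>: "\<alpha> > - 1 / 2" and f: "f \<in> entire_functions"
  shows "(dunkl \<alpha> ^^ m) f 0 = (deriv ^^ m) f 0 / fact m * of_real (dunkl_fact \<alpha> m)"
proof -
  define w where "w n = (deriv ^^ n) f 0 / fact n * of_real (dunkl_fact \<alpha> n)" for n
  have "(\<lambda>n. w n / of_real (dunkl_fact \<alpha> n) * z ^ n) sums f z" for z
    using entire_taylor_sums[OF f, of z] dunkl_fact_pos[OF \<alpha>] by (simp add: w_def less_le)
  from dunkl_funpow_sums[OF \<alpha> this, of m 0] have "(dunkl \<alpha> ^^ m) f 0 = w m"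
    using powser_sums_zero[of "\<lambda>n. w (n + m) / of_real (dunkl_fact \<alpha> n)"] sums_unique2 by fastforce
  then show ?thesis by (simp add: w_def)
qed

section \<open>Integral means and Taylor coefficients\<close>

lemma powr_above_tangent:
  fixes x m q :: real
  assumes "x \<ge> 0" "m > 0" "q \<ge> 1"
  shows "m powr q + q * m powr (q - 1) * (x - m) \<le> x powr q"
proof (cases "x = 0")
  \<comment> \<open>The tangent argument covers x > 0; at x = 0 the left side is (1 - q)
    \<open>m powr q\<close>, which is not positive.\<close>
  case True
  have "m powr (q - 1) * m = m powr q"
    using assms by (simp add: powr_diff)
  then show ?thesis using True assms by (simp add: mult.assoc)
next
  case False
  have "x powr q - m powr q \<ge> (q * m powr (q - 1)) * (x - m)"
    by (rule convex_on_imp_above_tangent[OF powr_convex[OF assms(3)]])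
       (use False assms in \<open>auto simp: interior_open intro!: derivative_eq_intros\<close>)
  then show ?thesis by simp
qed

lemma continuous_on_circle:
  assumes "f \<in> entire_functions"
  shows "continuous_on A (\<lambda>t. f (rcis r t))"
proof -
  have "continuous_on UNIV f"
    using assms by (auto simp: entire_functions_def intro: holomorphic_on_imp_continuous_on)
  then show ?thesis
    by (rule continuous_on_compose2) (auto simp: rcis_def intro!: continuous_intros)
qed

text \<open>Cauchy's integral formula on the circle of radius r, estimated by the mean of the
  modulus instead of its maximum so that it applies to every p.\<close>

lemma taylor_coeff_le_mean:
  assumes f: "f \<in> entire_functions" and r: "r > 0"
  shows "norm ((deriv ^^ n) f 0 / fact n) * r ^ n \<le> integral {0..2 * pi} (\<lambda>t. norm (f (rcis r t))) / (2 * pi)"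
proof -
  define a where "a = (deriv ^^ n) f 0 / fact n"
  have "((\<lambda>u. f u / (u - 0) ^ Suc n) has_contour_integral ((2 * pi * \<i>) / fact n * (deriv ^^ n) f 0))
      (circlepath 0 r)"
    using f r by (intro Cauchy_has_contour_integral_higher_derivative_circlepath)
      (auto simp: entire_functions_def intro: holomorphic_on_subset holomorphic_on_imp_continuous_on)
  then have I: "((\<lambda>t. f (rcis r t) / (rcis r t) ^ Suc n * r * \<i> * cis t) has_integral (2 * pi * \<i> * a)) {0..2 * pi}"
    by (simp add: circlepath_def has_contour_integral_part_circlepath_iff rcis_def a_def)
  have "norm (f (rcis r t) / (rcis r t) ^ Suc n * r * \<i> * cis t) \<le> norm (f (rcis r t)) / r ^ n" for t
    using r by (simp add: norm_mult norm_divide norm_power)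
  then have "norm (2 * pi * \<i> * a) \<le> integral {0..2 * pi} (\<lambda>t. norm (f (rcis r t)) / r ^ n)"
    unfolding integral_unique[OF I, symmetric]
    using r by (intro integral_norm_bound_integral has_integral_integrable[OF I]
        integrable_continuous_real continuous_intros continuous_on_circle[OF f]) auto
  also have "\<dots> = integral {0..2 * pi} (\<lambda>t. norm (f (rcis r t))) / r ^ n"
    by simp
  finally show ?thesis
    using r unfolding a_def[symmetric] by (simp add: norm_mult field_simps)
qed

text \<open>Jensen's inequality: for finite p = q the tangent to \<open>x powr q\<close> at the mean
  m is integrated, and its linear term drops out. The tangent point must be positive, so m = 0 is
  split off.\<close>

lemma mean_le_integral_mean:
  assumes f: "f \<in> entire_functions" and r: "r > 0" and p: "1 \<le> p"
  shows "integral {0..2 * pi} (\<lambda>t. norm (f (rcis r t))) / (2 * pi) \<le> integral_mean p f r"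
proof -
  define g where "g = (\<lambda>t. norm (f (rcis r t)))"
  have g: "continuous_on {0..2 * pi} g"
    unfolding g_def by (intro continuous_intros continuous_on_circle[OF f])
  have gi: "g integrable_on {0..2 * pi}" by (rule integrable_continuous_real[OF g])
  define m where "m = integral {0..2 * pi} g / (2 * pi)"
  have m0: "m \<ge> 0" unfolding m_def
    by (intro divide_nonneg_nonneg integral_nonneg gi) (auto simp: g_def)
  have "m \<le> integral_mean p f r"
  proof (cases p)
    case (real q)
    then have q: "q \<ge> 1" using p by simp
    have qi: "(\<lambda>t. g t powr q) integrable_on {0..2 * pi}"
      using q by (intro integrable_continuous_real continuous_on_powr' continuous_intros g) (auto simp: g_def)
    define J where "J = integral {0..2 * pi} (\<lambda>t. g t powr q) / (2 * pi)"
    have J: "integral_mean p f r = J powr (1 / q)"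
      using real by (simp add: integral_mean_def J_def g_def)
    show ?thesis
    proof (cases "m = 0")
      case False
      then have m: "m > 0" using m0 by simp
      have ti: "(\<lambda>t. m powr q + q * m powr (q - 1) * (g t - m)) integrable_on {0..2 * pi}"
        by (intro integrable_continuous_real continuous_intros g)
      have "integral {0..2 * pi} (\<lambda>t. m powr q + q * m powr (q - 1) * (g t - m)) \<le>
          integral {0..2 * pi} (\<lambda>t. g t powr q)"
        using m q by (intro integral_le ti qi powr_above_tangent) (simp_all add: g_def)
      moreover have "((\<lambda>t. m powr q + q * m powr (q - 1) * (g t - m)) has_integral
          (2 * pi * m powr q + q * m powr (q - 1) * (integral {0..2 * pi} g - 2 * pi * m))) {0..2 * pi}"
      proof -
        have "((\<lambda>_. c) has_integral 2 * pi * c) {0..2 * pi}" for c :: real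
          using has_integral_const_real[of c 0 "2 * pi"] by simp
        then show ?thesis
          by (intro has_integral_add has_integral_diff has_integral_mult_right integrable_integral gi)
      qed
      then have "integral {0..2 * pi} (\<lambda>t. m powr q + q * m powr (q - 1) * (g t - m)) = 2 * pi * m powr q"
        by (simp add: integral_unique m_def)
      ultimately have "m powr q \<le> J" by (simp add: J_def field_simps)
      then have "(m powr q) powr (1 / q) \<le> J powr (1 / q)"
        using q by (intro powr_mono2) auto
      then show ?thesis using m q by (simp add: J powr_powr)
    qed (simp add: J)
  next
    case PInf
    have bd: "bdd_above ((\<lambda>z. norm (f z)) ` sphere 0 r)"
      using f by (intro bounded_imp_bdd_above compact_imp_bounded compact_continuous_image continuous_intros)
        (auto simp: entire_functions_def intro: holomorphic_on_subset holomorphic_on_imp_continuous_on)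
    have "g t \<le> integral_mean p f r" for t
      using PInf r unfolding g_def integral_mean_def by (auto intro!: cSUP_upper bd)
    then have "integral {0..2 * pi} g \<le> integral {0..2 * pi} (\<lambda>t. integral_mean p f r)"
      by (intro integral_le gi) auto
    then show ?thesis by (simp add: m_def field_simps)
  qed (use p in auto)
  then show ?thesis by (simp add: m_def g_def)
qed

lemma integral_mean_le:
  assumes f: "f \<in> entire_functions" and r: "r > 0" and p: "1 \<le> p"
    and B: "\<And>z. norm z = r \<Longrightarrow> norm (f z) \<le> B"
  shows "integral_mean p f r \<le> B"
proof (cases p)
  case (real q)
  then have q: "q \<ge> 1" using p by simp
  have B0: "B \<ge> 0" using order_trans[OF norm_ge_zero B[of "of_real r"]] r by simp
  have "integral {0..2 * pi} (\<lambda>t. norm (f (rcis r t)) powr q) \<le> integral {0..2 * pi} (\<lambda>t. B powr q)"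
    using q r by (intro integral_le integrable_continuous_real continuous_on_powr' continuous_intros
        continuous_on_circle[OF f] powr_mono2 B) auto
  then have "1 / (2 * pi) * integral {0..2 * pi} (\<lambda>t. norm (f (rcis r t)) powr q) \<le> B powr q"
    by (simp add: field_simps)
  moreover have "0 \<le> integral {0..2 * pi} (\<lambda>t. norm (f (rcis r t)) powr q)"
    using q by (intro integral_nonneg integrable_continuous_real continuous_on_powr' continuous_intros
        continuous_on_circle[OF f]) auto
  ultimately have "integral_mean p f r \<le> (B powr q) powr (1 / q)"
    using real q unfolding integral_mean_def by (auto intro!: powr_mono2)
  then show ?thesis using q B0 by (simp add: powr_powr)
next
  case PInf
  then show ?thesis
    unfolding integral_mean_def using r B by (auto intro!: cSUP_least)
qed (use p in auto)

section \<open>Hypercyclicity as uniform approximation by iterates\<close>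

lemma dunkl_hypercyclicD:
  assumes f: "dunkl_hypercyclic \<alpha> f" and g: "g \<in> entire_functions" and K: "compact K" and e: "e > 0"
  obtains n where "n \<ge> 1" "\<And>z. z \<in> K \<Longrightarrow> norm ((dunkl \<alpha> ^^ n) f z - g z) < e"
proof -
  have "g \<in> entire_topology closure_of {(dunkl \<alpha> ^^ n) f | n. n \<ge> 1}"
    using f g by (simp add: dunkl_hypercyclic_def)
  moreover have "g \<in> unif_nbhd g K e" using g e by (simp add: unif_nbhd_def)
  ultimately have "\<exists>h. h \<in> {(dunkl \<alpha> ^^ n) f | n. n \<ge> 1} \<and> h \<in> unif_nbhd g K e"
    using openin_unif_nbhd[OF g K, of e] unfolding in_closure_of by blast
  then show thesis using that by (auto simp: unif_nbhd_def)
qed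

text \<open>Every compact set lies in a closed disc about 0, so approximation on such discs controls
  all basic neighbourhoods.\<close>

lemma dunkl_hypercyclicI:
  assumes f: "f \<in> entire_functions"
    and dense: "\<And>g R e. g \<in> entire_functions \<Longrightarrow> R > 0 \<Longrightarrow> e > 0 \<Longrightarrow>
      \<exists>n\<ge>1. \<forall>z. norm z \<le> R \<longrightarrow> norm ((dunkl \<alpha> ^^ n) f z - g z) < e"
  shows "dunkl_hypercyclic \<alpha> f"
proof -
  have orbit: "(dunkl \<alpha> ^^ n) f \<in> entire_functions" for n
    by (induction n) (auto simp: f dunkl_entire)
  have "g \<in> entire_topology closure_of {(dunkl \<alpha> ^^ n) f | n. n \<ge> 1}" if g: "g \<in> entire_functions" for g
    unfolding in_closure_of
  proof (intro conjI allI impI)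
    fix T assume "g \<in> T \<and> openin entire_topology T"
    then obtain K e where K: "compact K" "e > 0" "unif_nbhd g K e \<subseteq> T"
      by (auto simp: openin_entire_topology)
    obtain R where R: "R > 0" "\<And>z. z \<in> K \<Longrightarrow> norm z \<le> R"
      using compact_imp_bounded[OF K(1)] by (auto simp: bounded_pos)
    obtain n where "n \<ge> 1" "\<And>z. norm z \<le> R \<Longrightarrow> norm ((dunkl \<alpha> ^^ n) f z - g z) < e"
      using dense[OF g R(1) K(2)] by blast
    then have "(dunkl \<alpha> ^^ n) f \<in> unif_nbhd g K e" using orbit R(2) by (simp add: unif_nbhd_def)
    then show "\<exists>h. h \<in> {(dunkl \<alpha> ^^ n) f | n. n \<ge> 1} \<and> h \<in> T"
      using K(3) \<open>n \<ge> 1\<close> by blast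
  qed (use g in simp)
  then have "entire_topology closure_of {(dunkl \<alpha> ^^ n) f | n. n \<ge> 1} = topspace entire_topology"
    using closure_of_subset_topspace[of entire_topology] by auto
  then show ?thesis using f by (simp add: dunkl_hypercyclic_def)
qed

section \<open>Nonexistence at the critical rate\<close>

theorem dunkl_hypercyclic_growth_lower:
  assumes \<alpha>: "\<alpha> > - 1 / 2" and p: "1 \<le> p" and f: "dunkl_hypercyclic \<alpha> f"
    and C: "\<And>r. r > 0 \<Longrightarrow> integral_mean p f r \<le> C * (exp r / r powr (\<alpha> + 1))" and C0: "C > 0"
  shows False
proof -
  have ent: "f \<in> entire_functions" using f by (simp add: dunkl_hypercyclic_def)
  obtain K where K: "\<And>n. dunkl_fact \<alpha> n * (exp (real n + \<alpha> + 1) / (real n + \<alpha> + 1) powr (\<alpha> + 1)) / (real n + \<alpha> + 1) ^ n \<le> K"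
    using dunkl_fact_bounds[OF \<alpha>] by metis
  have bound: "norm ((dunkl \<alpha> ^^ n) f 0) \<le> C * K" for n
  proof -
    \<comment> \<open>At this radius the growth bound divided by \<open>s ^ n\<close> is comparable
      to the reciprocal weight.\<close>
    define s where "s = real n + \<alpha> + 1"
    have s: "s > 0" using \<alpha> by (simp add: s_def)
    define E where "E = exp s / s powr (\<alpha> + 1)"
    define a where "a = norm ((deriv ^^ n) f 0 / fact n)"
    have "a * s ^ n \<le> C * E"
      using taylor_coeff_le_mean[OF ent s, of n] mean_le_integral_mean[OF ent s p] C[OF s]
      unfolding a_def E_def by linarith
    then have "a \<le> C * E / s ^ n" using s by (simp add: field_simps)
    then have "a * dunkl_fact \<alpha> n \<le> C * E / s ^ n * dunkl_fact \<alpha> n"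
      using dunkl_fact_pos[OF \<alpha>, of n] by (intro mult_right_mono) auto
    also have "\<dots> = C * (dunkl_fact \<alpha> n * E / s ^ n)" by simp
    also have "\<dots> \<le> C * K"
      using K[of n] C0 unfolding s_def E_def by (intro mult_left_mono) auto
    finally show ?thesis
      using dunkl_fact_pos[OF \<alpha>, of n]
      unfolding dunkl_funpow_at_zero[OF \<alpha> ent] norm_mult a_def by simp
  qed
  \<comment> \<open>This constant has distance at least 1 from every orbit value at 0, so the
    compact set consisting of 0 alone already contradicts density.\<close>
  have "(\<lambda>_. of_real (C * K + 1)) \<in> entire_functions" by (simp add: entire_functions_def)
  then obtain n where n: "norm ((dunkl \<alpha> ^^ n) f 0 - of_real (C * K + 1)) < 1"
    using dunkl_hypercyclicD[OF f _ compact_sing[of 0] zero_less_one] by (metis singletonI)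
  have "C * K \<ge> 0" using order_trans[OF norm_ge_zero bound] .
  then have "C * K + 1 = norm (of_real (C * K + 1) :: complex)" unfolding norm_of_real by simp
  also have "\<dots> < C * K + 1"
    using n bound[of n] norm_triangle_ineq2[of "of_real (C * K + 1)" "(dunkl \<alpha> ^^ n) f 0"]
    by (simp add: norm_minus_commute)
  finally show False by simp
qed

section \<open>A countable dense set of polynomials and the size of their shifts\<close>

lemma dense_sequence_exists:
  obtains q :: "nat \<Rightarrow> 'a::{metric_space, second_countable_topology}"
    where "\<And>c e. e > 0 \<Longrightarrow> \<exists>i. dist (q i) c < e"
proof -
  obtain D :: "'a set" where D: "countable D" "\<And>X. open X \<Longrightarrow> X \<noteq> {} \<Longrightarrow> \<exists>d\<in>D. d \<in> X"
    using countable_dense_exists by blast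
  have "D \<noteq> {}" using D(2)[of UNIV] by auto
  show thesis
  proof (rule that[of "from_nat_into D"])
    fix c :: 'a and e :: real assume "e > 0"
    then obtain d where "d \<in> D" "d \<in> ball c e" using D(2)[of "ball c e"] by auto
    then show "\<exists>i. dist (from_nat_into D i) c < e"
      using from_nat_into_surj[OF D(1)] by (metis dist_commute mem_ball)
  qed
qed

text \<open>The Taylor series is truncated, then each coordinate
  \<open>of_real (\<gamma> k) * a k\<close> is replaced by a nearby value of q. Recording only the
  list of indices makes the approximants countable.\<close>

lemma entire_approx_by_polynomial:
  fixes q :: "nat \<Rightarrow> complex"
  assumes \<alpha>: "\<alpha> > - 1 / 2" and q: "\<And>c e. e > 0 \<Longrightarrow> \<exists>i. dist (q i) c < e"
    and g: "g \<in> entire_functions" and R: "R > 0" and e: "e > 0"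
  shows "\<exists>L. \<forall>z. norm z \<le> R \<longrightarrow>
    norm ((\<Sum>k<length L. q (L ! k) / of_real (dunkl_fact \<alpha> k) * z ^ k) - g z) < e"
proof -
  define a where "a n = (deriv ^^ n) g 0 / fact n" for n
  define \<gamma> where "\<gamma> = dunkl_fact \<alpha>"
  have \<gamma>: "\<gamma> k > 0" for k unfolding \<gamma>_def by (rule dunkl_fact_pos[OF \<alpha>])
  have a: "(\<lambda>n. a n * z ^ n) sums g z" for z
    unfolding a_def by (rule entire_taylor_sums[OF g])
  have "summable (\<lambda>n. norm (a n * of_real R ^ n))"
    by (rule powser_insidea[OF sums_summable[OF a[of "of_real (R + 1)"]]])
       (use R in \<open>simp only: norm_of_real\<close>)
  then have sR: "summable (\<lambda>n. norm (a n) * R ^ n)"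
    using R by (simp add: norm_mult norm_power)
  obtain N where N: "norm (\<Sum>i. norm (a (i + N)) * R ^ (i + N)) < e / 2"
    using suminf_exist_split[of "e / 2", OF _ sR] e by auto
  define S where "S = (\<Sum>k<N. R ^ k / \<gamma> k)"
  have S: "S \<ge> 0" unfolding S_def using R \<gamma> by (intro sum_nonneg) (simp add: less_imp_le)
  \<comment> \<open>Moving each coordinate by less than \<delta> changes the polynomial on the disc
    by at most \<delta> S. The summand 1 keeps the denominator positive even if S = 0.\<close>
  define \<delta> where "\<delta> = e / (2 * (S + 1))"
  have \<delta>: "\<delta> > 0" "\<delta> * S \<le> e / 2" using e S by (auto simp: \<delta>_def field_simps)
  have "\<forall>k. \<exists>i. dist (q i) (of_real (\<gamma> k) * a k) < \<delta>"
    using q[OF \<delta>(1)] by blast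
  then obtain i where i: "\<And>k. dist (q (i k)) (of_real (\<gamma> k) * a k) < \<delta>"
    by metis
  have "norm ((\<Sum>k<length (map i [0..<N]). q (map i [0..<N] ! k) / of_real (\<gamma> k) * z ^ k) - g z) < e"
    if z: "norm z \<le> R" for z
  proof -
    have "norm ((\<Sum>k<N. q (i k) / of_real (\<gamma> k) * z ^ k) - (\<Sum>k<N. a k * z ^ k)) \<le>
        (\<Sum>k<N. \<delta> * (R ^ k / \<gamma> k))"
      unfolding sum_subtractf[symmetric]
    proof (rule sum_norm_le)
      fix k
      have "q (i k) / of_real (\<gamma> k) * z ^ k - a k * z ^ k =
          (q (i k) - of_real (\<gamma> k) * a k) * (z ^ k / of_real (\<gamma> k))"
        using \<gamma>[of k] by (simp add: field_simps)
      also have "norm \<dots> \<le> \<delta> * (R ^ k / \<gamma> k)"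
        unfolding norm_mult norm_divide norm_power norm_of_real
        using i[of k] z R \<gamma>[of k] \<delta>(1)
        by (intro mult_mono divide_mono power_mono) (auto simp: dist_norm)
      finally show "norm (q (i k) / of_real (\<gamma> k) * z ^ k - a k * z ^ k) \<le> \<delta> * (R ^ k / \<gamma> k)" .
    qed
    also have "\<dots> \<le> e / 2" using \<delta>(2) by (simp add: S_def sum_distrib_left)
    finally have 1: "norm ((\<Sum>k<N. q (i k) / of_real (\<gamma> k) * z ^ k) - (\<Sum>k<N. a k * z ^ k)) \<le> e / 2" .
    have "(\<lambda>k. a (k + N) * z ^ (k + N)) sums (g z - (\<Sum>k<N. a k * z ^ k))"
      using a[of z] by (subst sums_iff_shift) simp
    then have "norm (g z - (\<Sum>k<N. a k * z ^ k)) \<le> (\<Sum>k. norm (a (k + N)) * R ^ (k + N))"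
    proof (rule norm_sums_le)
      show "(\<lambda>k. norm (a (k + N)) * R ^ (k + N)) sums (\<Sum>k. norm (a (k + N)) * R ^ (k + N))"
        by (intro summable_sums summable_ignore_initial_segment[OF sR])
      show "norm (a (k + N) * z ^ (k + N)) \<le> norm (a (k + N)) * R ^ (k + N)" for k
        unfolding norm_mult norm_power using z by (intro mult_left_mono power_mono) auto
    qed
    with N have 2: "norm ((\<Sum>k<N. a k * z ^ k) - g z) < e / 2" by (simp add: norm_minus_commute)
    have "norm ((\<Sum>k<N. q (i k) / of_real (\<gamma> k) * z ^ k) - g z) < e"
      using norm_triangle_ineq[of "(\<Sum>k<N. q (i k) / of_real (\<gamma> k) * z ^ k) - (\<Sum>k<N. a k * z ^ k)"
          "(\<Sum>k<N. a k * z ^ k) - g z"] 1 2 by simp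
    then show ?thesis by simp
  qed
  then show ?thesis unfolding \<gamma>_def by blast
qed

text \<open>The sum of the moduli, on a circle of radius r, of the terms of a block with coordinates
  v placed at index m.\<close>

definition shifted_majorant :: "real \<Rightarrow> (nat \<Rightarrow> complex) \<Rightarrow> nat \<Rightarrow> nat \<Rightarrow> real \<Rightarrow> real" where
  "shifted_majorant \<alpha> v l m r = (\<Sum>k<l. norm (v k) * (r ^ (k + m) / dunkl_fact \<alpha> (k + m)))"

text \<open>For a fixed block each term at radius R tends to 0 by comparison with the exponential
  series; monotonicity in r makes this uniform up to R.\<close>

lemma shifted_majorant_small:
  assumes \<alpha>: "\<alpha> > - 1 / 2" and e: "e > 0" and R: "R \<ge> 0"
  shows "\<exists>N. \<forall>m\<ge>N. \<forall>r. 0 \<le> r \<longrightarrow> r \<le> R \<longrightarrow> shifted_majorant \<alpha> v l m r \<le> e"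
proof -
  have "(\<lambda>n. R ^ n / dunkl_fact \<alpha> n) \<longlonglongrightarrow> 0"
  proof (rule Lim_null_comparison)
    show "(\<lambda>n. R ^ n /\<^sub>R fact n) \<longlonglongrightarrow> 0"
      by (rule summable_LIMSEQ_zero[OF summable_exp_generic])
    show "\<forall>\<^sub>F n in sequentially. norm (R ^ n / dunkl_fact \<alpha> n) \<le> R ^ n /\<^sub>R fact n"
      using fact_le_dunkl_fact[OF \<alpha>] dunkl_fact_pos[OF \<alpha>] R
      by (auto intro!: always_eventually divide_left_mono simp: divide_inverse_commute[symmetric] abs_of_pos)
  qed
  then have "(\<lambda>m. R ^ (k + m) / dunkl_fact \<alpha> (k + m)) \<longlonglongrightarrow> 0" for k
    using LIMSEQ_ignore_initial_segment[of _ _ k] by (simp add: add.commute)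
  then have "(\<lambda>m. shifted_majorant \<alpha> v l m R) \<longlonglongrightarrow> 0"
    unfolding shifted_majorant_def by (intro tendsto_null_sum tendsto_mult_right_zero)
  from order_tendstoD(2)[OF this e] obtain N where N: "\<And>m. m \<ge> N \<Longrightarrow> shifted_majorant \<alpha> v l m R < e"
    by (auto simp: eventually_sequentially)
  have "shifted_majorant \<alpha> v l m r \<le> shifted_majorant \<alpha> v l m R" if "0 \<le> r" "r \<le> R" for m r
    unfolding shifted_majorant_def using that dunkl_fact_pos[OF \<alpha>]
    by (intro sum_mono mult_left_mono divide_right_mono power_mono) (auto intro: less_imp_le)
  then show ?thesis using N by (meson less_imp_le order_trans)
qed

section \<open>Sequences assembled from blocks\<close>

lemma block_sequence_exists:
  fixes v :: "nat \<Rightarrow> nat \<Rightarrow> 'a::zero" and l N :: "nat \<Rightarrow> nat"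
  obtains n w where "n 0 = (0::nat)" "strict_mono n"
    "\<And>j. n (Suc j) = n j + l j + N (Suc j) + 1"
    "\<And>j k. k < l j \<Longrightarrow> w (n j + k) = v j k"
    "\<And>j m. n j + l j \<le> m \<Longrightarrow> m < n (Suc j) \<Longrightarrow> w m = 0"
proof -
  \<comment> \<open>The zeros after block j keep block j + 1 at distance at least
    \<open>N (Suc j)\<close> from every earlier starting point. The extra 1 makes n strictly
    increasing even for empty blocks.\<close>
  define n where "n = rec_nat 0 (\<lambda>j x. x + l j + N (Suc j) + 1)"
  have n: "n 0 = 0" "n (Suc j) = n j + l j + N (Suc j) + 1" for j by (simp_all add: n_def)
  have mono: "strict_mono n" by (rule strict_monoI_Suc) (simp add: n)
  define b where "b m = (LEAST j. m < n (Suc j))" for m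
  have b: "b m = j" if "n j \<le> m" "m < n (Suc j)" for j m
    unfolding b_def
  proof (rule Least_equality)
    show "m < n (Suc j)" by (rule that(2))
    fix i assume "m < n (Suc i)"
    with that(1) have "n j < n (Suc i)" by simp
    then show "j \<le> i" using mono by (simp add: strict_mono_less)
  qed
  define w where "w m = (if m < n (b m) + l (b m) then v (b m) (m - n (b m)) else 0)" for m
  show thesis
  proof (rule that[of n w])
    show "w (n j + k) = v j k" if "k < l j" for j k
      using that b[of j "n j + k"] by (simp add: w_def n)
    show "w m = 0" if "n j + l j \<le> m" "m < n (Suc j)" for j m
      using that b[of j m] by (simp add: w_def)
  qed (use n mono in auto)
qed

lemma sum_over_blocks:
  fixes h :: "nat \<Rightarrow> 'b::comm_monoid_add"
  assumes mono: "strict_mono n" and gap: "\<And>i. n i + l i \<le> n (Suc i)" and "j \<le> J"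
    and zero: "\<And>i m. n i + l i \<le> m \<Longrightarrow> m < n (Suc i) \<Longrightarrow> h m = 0"
  shows "(\<Sum>m=n j..<n J. h m) = (\<Sum>i=j..<J. \<Sum>k<l i. h (n i + k))"
  using \<open>j \<le> J\<close>
proof (induction J rule: dec_induct)
  case (step J)
  have "(\<Sum>m=n J..<n (Suc J). h m) = (\<Sum>m=n J..<n J + l J. h m)"
    using gap[of J] zero[of J] by (intro sum.mono_neutral_right) auto
  also have "\<dots> = (\<Sum>k<l J. h (n J + k))"
    by (rule sum.reindex_bij_witness[of _ "\<lambda>k. n J + k" "\<lambda>m. m - n J"]) auto
  finally have "(\<Sum>m=n J..<n (Suc J). h m) = (\<Sum>k<l J. h (n J + k))" .
  moreover have "(\<Sum>m=n j..<n (Suc J). h m) = (\<Sum>m=n j..<n J. h m) + (\<Sum>m=n J..<n (Suc J). h m)"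
    by (rule sum.atLeastLessThan_concat[symmetric])
      (use mono step in \<open>simp_all add: strict_mono_less_eq\<close>)
  ultimately show ?case using step by simp
qed simp

lemma sum_half_powers_le: "(\<Sum>i=a..<b. (1 / 2 :: real) ^ Suc i) \<le> (1 / 2) ^ a"
proof (cases "a \<le> b")
  case True
  then have "(\<Sum>i=a..<b. (1 / 2 :: real) ^ Suc i) = (1 / 2) ^ a - (1 / 2) ^ b"
    by (induction b rule: dec_induct) auto
  then show ?thesis by simp
qed simp

text \<open>Here s counts the left shifts already applied: 0 for the growth estimate, the start of
  the preceding block for density. Since s is at most \<open>n j\<close>, the truncated subtractions
  are exact.\<close>

lemma weighted_block_sum:
  fixes w :: "nat \<Rightarrow> complex"
  assumes mono: "strict_mono n" and gap: "\<And>i. n i + l i \<le> n (Suc i)"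
    and block: "\<And>i k. k < l i \<Longrightarrow> w (n i + k) = v i k"
    and zero: "\<And>i m. n i + l i \<le> m \<Longrightarrow> m < n (Suc i) \<Longrightarrow> w m = 0"
    and "j \<le> J" and "s \<le> n j"
  shows "(\<Sum>m=n j..<n J. norm (w m) * (r ^ (m - s) / dunkl_fact \<alpha> (m - s))) =
    (\<Sum>i=j..<J. shifted_majorant \<alpha> (v i) (l i) (n i - s) r)"
proof -
  have "n i + k - s = k + (n i - s)" if "j \<le> i" for i k
    using that mono \<open>s \<le> n j\<close> strict_mono_less_eq[OF mono, of j i] by simp
  then show ?thesis
    using zero block by (subst sum_over_blocks[OF mono gap \<open>j \<le> J\<close>])
      (auto simp: shifted_majorant_def intro!: sum.cong)
qed

text \<open>
  In the coordinates \<open>w m\<close> the Dunkl operator is the left shift, so applying it \<open>n j\<close> times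
  brings block \<open>j\<close> to the front and leaves only the later blocks behind it.
\<close>

lemma hypercyclic_block_series:
  fixes q :: "nat \<Rightarrow> complex" and w :: "nat \<Rightarrow> complex" and dec :: "nat \<Rightarrow> nat list"
  defines "v \<equiv> \<lambda>j k. q (dec j ! k)" and "l \<equiv> \<lambda>j. length (dec j)"
  assumes \<alpha>: "\<alpha> > - 1 / 2" and q: "\<And>c e. e > 0 \<Longrightarrow> \<exists>i. dist (q i) c < e"
    and dec: "\<And>L m. \<exists>j\<ge>m. dec j = L"
    and mono: "strict_mono n" and gap: "\<And>i. n i + l i \<le> n (Suc i)"
    and block: "\<And>i k. k < l i \<Longrightarrow> w (n i + k) = v i k"
    and zero: "\<And>i m. n i + l i \<le> m \<Longrightarrow> m < n (Suc i) \<Longrightarrow> w m = 0"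
    and small: "\<And>i j r. j < i \<Longrightarrow> 0 \<le> r \<Longrightarrow> r \<le> real i \<Longrightarrow>
      shifted_majorant \<alpha> (v i) (l i) (n i - n j) r \<le> (1 / 2) ^ Suc i"
    and f: "\<And>z. (\<lambda>m. w m / of_real (dunkl_fact \<alpha> m) * z ^ m) sums f z"
  shows "dunkl_hypercyclic \<alpha> f"
proof (rule dunkl_hypercyclicI)
  show "f \<in> entire_functions" by (rule entire_power_series(1)[OF f])
next
  fix g and R e :: real assume g: "g \<in> entire_functions" and R: "R > 0" and e: "e > 0"
  obtain L where L: "\<And>z. norm z \<le> R \<Longrightarrow>
      norm ((\<Sum>k<length L. q (L ! k) / of_real (dunkl_fact \<alpha> k) * z ^ k) - g z) < e / 2"
    using entire_approx_by_polynomial[OF \<alpha> q g R, of "e / 2"] e by auto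
  obtain m1 where m1: "R \<le> real m1" using real_arch_simple by blast
  obtain m2 where m2: "(1 / 2) ^ m2 < e / 2" using real_arch_pow_inv[of "e / 2" "1 / 2"] e by auto
  \<comment> \<open>Lists recur arbitrarily late. The bound m1 gives R <= j as required by
    \<open>small\<close>, m2 makes the tail less than e / 2, and 1 excludes the zeroth
    iterate.\<close>
  obtain j where j: "j \<ge> max m1 (max m2 1)" "dec j = L" using dec by blast
  have nj: "n j \<ge> 1" using seq_suble[OF mono, of j] j(1) by simp
  \<comment> \<open>After \<open>n j\<close> shifts the next block begins at index M, so the first M
    terms are exactly the polynomial coded by L.\<close>
  define M where "M = n (Suc j) - n j"
  have M: "M + n j = n (Suc j)" using gap[of j] by (simp add: M_def)
  have "norm ((dunkl \<alpha> ^^ n j) f z - g z) < e" if z: "norm z \<le> R" for z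
  proof -
    define h where "h m = w (m + n j) / of_real (dunkl_fact \<alpha> m) * z ^ m" for m
    have h: "h sums (dunkl \<alpha> ^^ n j) f z"
      unfolding h_def by (rule dunkl_funpow_sums[OF \<alpha> f])
    have "(\<Sum>m<M. h m) = (\<Sum>m<l j. h m)"
      using gap[of j] zero[of j] M
      by (intro sum.mono_neutral_right) (auto simp: h_def M_def not_less add.commute)
    also have "\<dots> = (\<Sum>k<length L. q (L ! k) / of_real (dunkl_fact \<alpha> k) * z ^ k)"
      using block[of _ j] j(2) by (intro sum.cong) (auto simp: h_def l_def v_def add.commute)
    finally have head: "norm ((\<Sum>m<M. h m) - g z) < e / 2" using L[OF z] by simp
    have part: "(\<Sum>m<t. norm (h (m + M))) \<le> (1 / 2) ^ Suc j" for t
    proof -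
      have "(\<Sum>m<t. norm (h (m + M))) = (\<Sum>m=n (Suc j)..<n (Suc j) + t.
          norm (w m) * (norm z ^ (m - n j) / dunkl_fact \<alpha> (m - n j)))"
        using M dunkl_fact_pos[OF \<alpha>]
        by (intro sum.reindex_bij_witness[of _ "\<lambda>m. m - n (Suc j)" "\<lambda>m. m + n (Suc j)"])
          (auto simp: h_def norm_mult norm_divide norm_power abs_of_pos M_def add.assoc)
      \<comment> \<open>The range is enlarged to end at the start of a block, so that it splits into
        whole blocks.\<close>
      also have "\<dots> \<le> (\<Sum>m=n (Suc j)..<n (Suc j + t).
          norm (w m) * (norm z ^ (m - n j) / dunkl_fact \<alpha> (m - n j)))"
      proof (rule sum_mono2)
        have "n (Suc j) + t \<le> n (Suc j + t)"
        proof (induction t)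
          case (Suc t)
          then show ?case using strict_monoD[OF mono, of "Suc j + t" "Suc j + Suc t"] by simp
        qed simp
        then show "{n (Suc j)..<n (Suc j) + t} \<subseteq> {n (Suc j)..<n (Suc j + t)}" by auto
        show "norm (w m) * (norm z ^ (m - n j) / dunkl_fact \<alpha> (m - n j)) \<ge> 0" for m
          using dunkl_fact_pos[OF \<alpha>, of "m - n j"] by simp
      qed simp
      also have "\<dots> = (\<Sum>i=Suc j..<Suc j + t. shifted_majorant \<alpha> (v i) (l i) (n i - n j) (norm z))"
        using gap[of j] by (intro weighted_block_sum mono gap block zero) auto
      also have "\<dots> \<le> (\<Sum>i=Suc j..<Suc j + t. (1 / 2) ^ Suc i)"
        using z m1 j(1) by (intro sum_mono small) auto
      also have "\<dots> \<le> (1 / 2) ^ Suc j" by (rule sum_half_powers_le)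
      finally show ?thesis .
    qed
    have sm: "summable (\<lambda>m. norm (h (m + M)))"
      by (rule summableI_nonneg_bounded[OF _ part]) simp
    have "(\<lambda>m. h (m + M)) sums ((dunkl \<alpha> ^^ n j) f z - (\<Sum>m<M. h m))"
      using h by (subst sums_iff_shift) simp
    then have "norm ((dunkl \<alpha> ^^ n j) f z - (\<Sum>m<M. h m)) \<le> (\<Sum>m. norm (h (m + M)))"
      by (rule norm_sums_le[OF _ summable_sums[OF sm]]) simp
    also have "\<dots> \<le> (1 / 2) ^ Suc j" by (rule suminf_le_const[OF sm part])
    also have "\<dots> \<le> (1 / 2) ^ m2" using j(1) by (intro power_decreasing) auto
    finally show ?thesis
      using norm_triangle_ineq[of "(dunkl \<alpha> ^^ n j) f z - (\<Sum>m<M. h m)" "(\<Sum>m<M. h m) - g z"] head m2 by simp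
  qed
  then show "\<exists>n\<ge>1. \<forall>z. norm z \<le> R \<longrightarrow> norm ((dunkl \<alpha> ^^ n) f z - g z) < e" using nj by blast
qed

section \<open>Construction of a hypercyclic function of prescribed growth\<close>

lemma dunkl_hypercyclic_growth_upper:
  fixes \<phi> :: "real \<Rightarrow> real"
  assumes \<alpha>: "\<alpha> > - 1 / 2" and \<phi>: "filterlim \<phi> at_top at_top"
  shows "\<exists>f. dunkl_hypercyclic \<alpha> f \<and>
    (\<exists>r0>0. \<forall>z. norm z \<ge> r0 \<longrightarrow> norm (f z) \<le> \<phi> (norm z) * (exp (norm z) / norm z powr (\<alpha> + 1)))"
proof -
  obtain q :: "nat \<Rightarrow> complex" where q: "\<And>c e. e > 0 \<Longrightarrow> \<exists>i. dist (q i) c < e"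
    using dense_sequence_exists by blast
  \<comment> \<open>Dropping the second component of the pair makes every list occur for infinitely
    many j.\<close>
  define dec where "dec j = list_decode (fst (prod_decode j))" for j
  have dec: "\<exists>j\<ge>m. dec j = L" for L m
    by (intro exI[of _ "prod_encode (list_encode L, m)"]) (simp add: dec_def le_prod_encode_2)
  define v where "v j k = q (dec j ! k)" for j k
  define l where "l j = length (dec j)" for j
  define E where "E r = exp r / r powr (\<alpha> + 1)" for r :: real
  obtain K where K: "K > 0" "\<And>n r. r > 0 \<Longrightarrow> r ^ n / dunkl_fact \<alpha> n \<le> K * E r"
    using dunkl_fact_bounds[OF \<alpha>] unfolding E_def by metis
  \<comment> \<open>The cost of block i relative to E does not depend on its position, because K
    serves all powers at once. Hence the starting positions can be chosen after these
    constants.\<close>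
  define c where "c i = (\<Sum>k<l i. norm (v i k)) * K" for i
  have c0: "c i \<ge> 0" for i unfolding c_def using K(1) by (intro mult_nonneg_nonneg sum_nonneg) auto
  have P_le: "shifted_majorant \<alpha> (v i) (l i) m r \<le> c i * E r" if "r > 0" for i m r
  proof -
    have "shifted_majorant \<alpha> (v i) (l i) m r \<le> (\<Sum>k<l i. norm (v i k) * (K * E r))"
      unfolding shifted_majorant_def using K(2)[OF that] by (intro sum_mono mult_left_mono) auto
    then show ?thesis by (simp add: c_def sum_distrib_right mult.assoc)
  qed
  \<comment> \<open>The summand 1 reserves room for the geometric total of the later blocks.\<close>
  have "\<exists>T>0. \<forall>r\<ge>T. (\<Sum>i\<le>j. c i) + 1 \<le> \<phi> r" for j
  proof -
    obtain r1 where "\<And>r. r \<ge> r1 \<Longrightarrow> (\<Sum>i\<le>j. c i) + 1 \<le> \<phi> r"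
      using \<phi> unfolding filterlim_at_top eventually_at_top_linorder by blast
    then show ?thesis by (intro exI[of _ "max r1 1"]) auto
  qed
  then obtain T where T: "\<And>j. T j > 0" "\<And>j r. r \<ge> T j \<Longrightarrow> (\<Sum>i\<le>j. c i) + 1 \<le> \<phi> r"
    by metis
  \<comment> \<open>On \<open>\<rho> j \<le> norm z < \<rho> (Suc j)\<close> the blocks up to \<open>j\<close> are controlled by the growth of \<open>\<phi>\<close>, while
    the later blocks are small because they start late.\<close>
  define \<rho> where "\<rho> j = (\<Sum>i\<le>j. T i + 1)" for j
  have \<rho>_Suc: "\<rho> (Suc j) = \<rho> j + T (Suc j) + 1" for j by (simp add: \<rho>_def)
  have \<rho>_gt: "\<rho> j > real j \<and> \<rho> j \<ge> T j" for j
  proof (induction j)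
    case (Suc j)
    then show ?case using T(1)[of "Suc j"] by (simp add: \<rho>_Suc)
  qed (use T(1)[of 0] in \<open>simp add: \<rho>_def\<close>)
  have \<rho>_pos: "\<rho> j > 0" for j using \<rho>_gt[of j] by (meson of_nat_0_le_iff order_le_less_trans)
  have \<rho>_mono: "\<rho> i \<le> \<rho> j" if "i \<le> j" for i j
  proof (rule lift_Suc_mono_le[OF _ that])
    show "\<rho> k \<le> \<rho> (Suc k)" for k using T(1)[of "Suc k"] by (simp add: \<rho>_Suc)
  qed
  \<comment> \<open>The bound 1 in the minimum serves density; the other is at most E r for 0 < r <=
    \<open>\<rho> j\<close> and serves growth.\<close>
  have "\<exists>N. \<forall>m\<ge>N. \<forall>r. 0 \<le> r \<longrightarrow> r \<le> \<rho> j \<longrightarrow> shifted_majorant \<alpha> (v j) (l j) m r \<le>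
      (1 / 2) ^ Suc j * min 1 (\<rho> j powr - (\<alpha> + 1))" for j
    using \<rho>_pos[of j] by (intro shifted_majorant_small[OF \<alpha>]) auto
  then obtain N where N: "\<And>j m r. m \<ge> N j \<Longrightarrow> 0 \<le> r \<Longrightarrow> r \<le> \<rho> j \<Longrightarrow>
      shifted_majorant \<alpha> (v j) (l j) m r \<le> (1 / 2) ^ Suc j * min 1 (\<rho> j powr - (\<alpha> + 1))"
    by metis
  obtain n w where n0: "n 0 = (0::nat)" and mono: "strict_mono n"
    and n_Suc: "\<And>j. n (Suc j) = n j + l j + N (Suc j) + 1"
    and block: "\<And>j k. k < l j \<Longrightarrow> w (n j + k) = v j k"
    and zero: "\<And>j m. n j + l j \<le> m \<Longrightarrow> m < n (Suc j) \<Longrightarrow> w m = 0"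
    by (rule block_sequence_exists[where v = v and l = l and N = N]) blast
  have gap: "n i + l i \<le> n (Suc i)" for i by (simp add: n_Suc)
  have N_le: "N i \<le> n i - n j" if "j < i" for i j
  proof -
    obtain i' where i': "i = Suc i'" using \<open>j < i\<close> by (cases i) auto
    then have "n j \<le> n i'" using \<open>j < i\<close> mono by (simp add: strict_mono_less_eq)
    then show ?thesis by (simp add: i' n_Suc)
  qed
  have far: "shifted_majorant \<alpha> (v i) (l i) (n i) r \<le> (1 / 2) ^ Suc i * E r"
    if "0 < i" "0 < r" "r \<le> \<rho> i" for i r
  proof -
    have "shifted_majorant \<alpha> (v i) (l i) (n i) r \<le> (1 / 2) ^ Suc i * min 1 (\<rho> i powr - (\<alpha> + 1))"
      using N_le[OF that(1)] n0 that by (intro N) auto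
    also have "\<dots> \<le> (1 / 2) ^ Suc i * E r"
    proof (intro mult_left_mono)
      have "\<rho> i powr - (\<alpha> + 1) \<le> r powr - (\<alpha> + 1)"
        using that \<alpha> by (intro powr_mono2') auto
      also have "\<dots> \<le> exp r * r powr - (\<alpha> + 1)"
        using mult_right_mono[of 1 "exp r" "r powr - (\<alpha> + 1)"] that by simp
      also have "\<dots> = E r" by (simp only: E_def powr_minus divide_inverse)
      finally show "min 1 (\<rho> i powr - (\<alpha> + 1)) \<le> E r" by simp
    qed simp
    finally show ?thesis .
  qed
  define a where "a r m = norm (w m) * (r ^ m / dunkl_fact \<alpha> m)" for r m
  have a0: "a r m \<ge> 0" if "r \<ge> 0" for r m
    unfolding a_def using that dunkl_fact_pos[OF \<alpha>, of m] by simp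
  have partial: "(\<Sum>m<t. a r m) \<le> \<phi> r * E r" if r: "r \<ge> \<rho> 0" for r t
  proof -
    have r0: "r > 0" using r \<rho>_pos[of 0] by simp
    have E0: "E r > 0" using r0 by (simp add: E_def)
    define j where "j = (LEAST j. r < \<rho> (Suc j))"
    obtain k where "r \<le> real k" using real_arch_simple by blast
    then have "r < \<rho> (Suc k)" using \<rho>_gt[of "Suc k"] by simp
    then have j1: "r < \<rho> (Suc j)" unfolding j_def by (rule LeastI)
    have j2: "\<rho> j \<le> r"
    proof (cases j)
      case (Suc j')
      then show ?thesis using not_less_Least[of j' "\<lambda>j. r < \<rho> (Suc j)"] by (simp add: j_def[symmetric])
    qed (use r in simp)
    have "(\<Sum>m<t. a r m) \<le> (\<Sum>m=n 0..<n t. a r m)"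
      using r0 a0 n0 seq_suble[OF mono, of t] by (intro sum_mono2) auto
    also have "\<dots> = (\<Sum>i=0..<t. shifted_majorant \<alpha> (v i) (l i) (n i) r)"
      using weighted_block_sum[where n = n and l = l and w = w and v = v and j = 0 and J = t and s = 0,
          OF mono gap block zero] by (simp add: a_def)
    also have "\<dots> \<le> (\<Sum>i=0..<t. ((if i \<le> j then c i else 0) + (1 / 2) ^ Suc i) * E r)"
    proof (rule sum_mono)
      fix i
      show "shifted_majorant \<alpha> (v i) (l i) (n i) r \<le> ((if i \<le> j then c i else 0) + (1 / 2) ^ Suc i) * E r"
      proof (cases "i \<le> j")
        case True
        have "shifted_majorant \<alpha> (v i) (l i) (n i) r \<le> c i * E r" by (rule P_le[OF r0])
        also have "\<dots> \<le> (c i + (1 / 2) ^ Suc i) * E r" using E0 by (intro mult_right_mono) auto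
        finally show ?thesis using True by simp
      next
        case False
        then show ?thesis using far[of i r] j1 \<rho>_mono[of "Suc j" i] r0 by simp
      qed
    qed
    also have "\<dots> = ((\<Sum>i=0..<t. if i \<le> j then c i else 0) + (\<Sum>i=0..<t. (1 / 2) ^ Suc i)) * E r"
      by (simp only: sum.distrib sum_distrib_right[symmetric])
    also have "\<dots> \<le> ((\<Sum>i\<le>j. c i) + 1) * E r"
    proof (intro mult_right_mono add_mono)
      have "(\<Sum>i=0..<t. if i \<le> j then c i else 0) = (\<Sum>i\<in>{0..<t} \<inter> {..j}. c i)"
        by (simp add: sum.inter_restrict)
      also have "\<dots> \<le> (\<Sum>i\<le>j. c i)" using c0 by (intro sum_mono2) auto
      finally show "(\<Sum>i=0..<t. if i \<le> j then c i else 0) \<le> (\<Sum>i\<le>j. c i)" .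
    qed (use E0 sum_half_powers_le[of 0 t] in auto)
    also have "\<dots> \<le> \<phi> r * E r"
      using T(2)[of j r] j2 \<rho>_gt[of j] E0 by (intro mult_right_mono) auto
    finally show ?thesis .
  qed
  have sa: "summable (a r)" if "r \<ge> \<rho> 0" for r
    using that \<rho>_pos[of 0] by (intro summableI_nonneg_bounded[OF a0 partial]) auto
  have na: "norm (w m / of_real (dunkl_fact \<alpha> m) * z ^ m) = a (norm z) m" for z m
    using dunkl_fact_pos[OF \<alpha>, of m] by (simp add: a_def norm_mult norm_divide norm_power)
  define f where "f z = (\<Sum>m. w m / of_real (dunkl_fact \<alpha> m) * z ^ m)" for z
  \<comment> \<open>Summability is known from radius \<open>\<rho> 0\<close> on, so smaller radii
    are dominated by that one.\<close>
  have f: "(\<lambda>m. w m / of_real (dunkl_fact \<alpha> m) * z ^ m) sums f z" for z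
    unfolding f_def
  proof (intro summable_sums summable_comparison_test[OF _ sa[of "max (norm z) (\<rho> 0)"]] exI allI impI)
    fix m
    show "norm (w m / of_real (dunkl_fact \<alpha> m) * z ^ m) \<le> a (max (norm z) (\<rho> 0)) m"
      unfolding na unfolding a_def using dunkl_fact_pos[OF \<alpha>, of m]
      by (intro mult_left_mono divide_right_mono power_mono) auto
  qed simp
  have "dunkl_hypercyclic \<alpha> f"
  proof (rule hypercyclic_block_series[OF \<alpha> q dec mono])
    show "n i + length (dec i) \<le> n (Suc i)" for i using gap by (simp add: l_def)
    show "w (n i + k) = q (dec i ! k)" if "k < length (dec i)" for i k
      using block that by (simp add: l_def v_def)
    show "w m = 0" if "n i + length (dec i) \<le> m" "m < n (Suc i)" for i m
      using zero that by (simp add: l_def)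
    show "shifted_majorant \<alpha> (\<lambda>k. q (dec i ! k)) (length (dec i)) (n i - n j) r \<le> (1 / 2) ^ Suc i"
      if "j < i" "0 \<le> r" "r \<le> real i" for i j r
    proof -
      have "shifted_majorant \<alpha> (v i) (l i) (n i - n j) r \<le> (1 / 2) ^ Suc i * min 1 (\<rho> i powr - (\<alpha> + 1))"
        using that \<rho>_gt[of i] by (intro N N_le) auto
      also have "\<dots> \<le> (1 / 2) ^ Suc i * 1" by (intro mult_left_mono) auto
      finally show ?thesis by (simp add: v_def[abs_def] l_def)
    qed
  qed (assumption | rule f)+
  moreover have "norm (f z) \<le> \<phi> (norm z) * E (norm z)" if "norm z \<ge> \<rho> 0" for z
  proof -
    have "norm (f z) \<le> suminf (a (norm z))"
      by (rule norm_sums_le[OF f summable_sums[OF sa[OF that]]]) (simp only: na order_refl)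
    also have "\<dots> \<le> \<phi> (norm z) * E (norm z)"
      by (rule suminf_le_const[OF sa[OF that] partial[OF that]])
    finally show ?thesis .
  qed
  ultimately show ?thesis using \<rho>_pos[of 0] unfolding E_def by blast
qed

theorem theorem3:
  fixes \<alpha> :: real and p :: ereal
  assumes "\<alpha> > - 1 / 2" and "1 \<le> p" and "p \<le> \<infinity>"
  shows "(\<forall>\<phi> :: real \<Rightarrow> real.
            (\<forall>r>0. \<phi> r > 0) \<and> filterlim \<phi> at_top at_top \<longrightarrow>
            (\<exists>f. dunkl_hypercyclic \<alpha> f \<and>
                 (\<forall>\<^sub>F r in at_top. integral_mean p f r \<le> \<phi> r * (exp r / r powr (\<alpha> + 1)))))
       \<and> \<not> (\<exists>f. dunkl_hypercyclic \<alpha> f \<and>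
                 (\<exists>C>0. \<forall>r>0. integral_mean p f r \<le> C * (exp r / r powr (\<alpha> + 1))))"
proof (intro conjI allI impI)
  fix \<phi> :: "real \<Rightarrow> real"
  assume "(\<forall>r>0. \<phi> r > 0) \<and> filterlim \<phi> at_top at_top"
  then obtain f r0 where f: "dunkl_hypercyclic \<alpha> f" and r0: "r0 > 0"
    "\<And>z. norm z \<ge> r0 \<Longrightarrow> norm (f z) \<le> \<phi> (norm z) * (exp (norm z) / norm z powr (\<alpha> + 1))"
    using dunkl_hypercyclic_growth_upper[OF assms(1)] by metis
  \<comment> \<open>A pointwise bound on the circle bounds every mean, so the same f works for all
    p.\<close>
  have "\<forall>\<^sub>F r in at_top. integral_mean p f r \<le> \<phi> r * (exp r / r powr (\<alpha> + 1))"
    using eventually_ge_at_top[of r0]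
  proof eventually_elim
    case (elim r)
    then show ?case
      using f r0 by (intro integral_mean_le assms) (auto simp: dunkl_hypercyclic_def)
  qed
  with f show "\<exists>f. dunkl_hypercyclic \<alpha> f \<and>
      (\<forall>\<^sub>F r in at_top. integral_mean p f r \<le> \<phi> r * (exp r / r powr (\<alpha> + 1)))" by blast
next
  show "\<not> (\<exists>f. dunkl_hypercyclic \<alpha> f \<and>
      (\<exists>C>0. \<forall>r>0. integral_mean p f r \<le> C * (exp r / r powr (\<alpha> + 1))))"
    using dunkl_hypercyclic_growth_lower[OF assms(1,2)] by blast
qed

end
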